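(* Let $Y$ be a continuum and let $X$ be a meager composant of $Y$ (that is, the meager composant in $Y$ of some point of $Y$). If $X$ is singular dense in $Y$, then there exist an indecomposable continuum $Z$ and a composant $P$ of $Z$ such that $X$ is homeomorphic to $P$ (with the subspace topologies).
   Context: A continuum is a connected compact metrizable space with more than one point. A subcontinuum of a continuum $Y$ is a non-empty compact connected subset of $Y$ (one-point subsets are allowed). A continuum $Y$ is decomposable if $Y=H\cup K$ for some two proper subcontinua $H,K\subsetneq Y$; otherwise it is indecomposable. For a continuum $Y$ and $x\in Y$: the composant of $x$ in $Y$ is the union of all proper subcontinua of $Y$ containing $x$; the meager composant of $x$ in $Y$ is the union of all subcontinua of $Y$ that contain $x$ and are nowhere dense in $Y$. A connected subset $X$ of a continuum $Y$ is singular with respect to a point $y\in Y$ if for every connected $C\subseteq X$ such that $y$ belongs to the closure of $C$ in $Y$, the closure of $C$ in $X$ equals $X$. $X$ is singular in $Y$ if it is singular with respect to some $y\in Y$, and singular dense in $Y$ if it is both singular in $Y$ and dense in $Y$. *)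

theory Defs
  imports "HOL-Analysis.Analysis"
begin

text \<open>Every continuum embeds in the Hilbert cube, so up to homeomorphism every continuum is a
  topology over the type \<^typ>\<open>nat \<Rightarrow> real\<close>; an existential claim about some continuum may
  therefore be stated over that type.\<close>

definition continuum :: "'a topology \<Rightarrow> bool" where
  "continuum Y \<longleftrightarrow>
     connected_space Y \<and> compact_space Y \<and> metrizable_space Y \<and>
     (\<exists>a \<in> topspace Y. \<exists>b \<in> topspace Y. a \<noteq> b)"

text \<open>One-point subcontinua are allowed; \<^const>\<open>compactin\<close> and \<^const>\<open>connectedin\<close>
  both include the requirement that the set lies in the carrier.\<close>

definition subcontinuum :: "'a topology \<Rightarrow> 'a set \<Rightarrow> bool" where
  "subcontinuum Y K \<longleftrightarrow> K \<noteq> {} \<and> compactin Y K \<and> connectedin Y K"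

definition proper_subcontinuum :: "'a topology \<Rightarrow> 'a set \<Rightarrow> bool" where
  "proper_subcontinuum Y K \<longleftrightarrow> subcontinuum Y K \<and> K \<noteq> topspace Y"

definition decomposable :: "'a topology \<Rightarrow> bool" where
  "decomposable Y \<longleftrightarrow>
     (\<exists>H K. proper_subcontinuum Y H \<and> proper_subcontinuum Y K \<and> topspace Y = H \<union> K)"

definition indecomposable_continuum :: "'a topology \<Rightarrow> bool" where
  "indecomposable_continuum Y \<longleftrightarrow> continuum Y \<and> \<not> decomposable Y"

definition nowhere_dense_in :: "'a topology \<Rightarrow> 'a set \<Rightarrow> bool" where
  "nowhere_dense_in Y A \<longleftrightarrow> A \<subseteq> topspace Y \<and> Y interior_of (Y closure_of A) = {}"

definition dense_subset_of :: "'a topology \<Rightarrow> 'a set \<Rightarrow> bool" where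
  "dense_subset_of Y A \<longleftrightarrow> A \<subseteq> topspace Y \<and> Y closure_of A = topspace Y"

definition composant :: "'a topology \<Rightarrow> 'a \<Rightarrow> 'a set" where
  "composant Y x = \<Union>{K. proper_subcontinuum Y K \<and> x \<in> K}"

definition meager_composant :: "'a topology \<Rightarrow> 'a \<Rightarrow> 'a set" where
  "meager_composant Y x = \<Union>{K. subcontinuum Y K \<and> nowhere_dense_in Y K \<and> x \<in> K}"

text \<open>The first closure is taken in \<open>Y\<close>, the second in the subspace \<open>X\<close>.\<close>

definition singular_wrt :: "'a topology \<Rightarrow> 'a set \<Rightarrow> 'a \<Rightarrow> bool" where
  "singular_wrt Y X y \<longleftrightarrow>
     connectedin Y X \<and> y \<in> topspace Y \<and>
     (\<forall>C. C \<subseteq> X \<and> connectedin Y C \<and> y \<in> Y closure_of C \<longrightarrow> (subtopology Y X) closure_of C = X)"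

definition singular_in :: "'a topology \<Rightarrow> 'a set \<Rightarrow> bool" where
  "singular_in Y X \<longleftrightarrow> (\<exists>y \<in> topspace Y. singular_wrt Y X y)"

definition singular_dense_in :: "'a topology \<Rightarrow> 'a set \<Rightarrow> bool" where
  "singular_dense_in Y X \<longleftrightarrow> singular_in Y X \<and> dense_subset_of Y X"

end

theory Submission
  imports Defs "HOL-Library.Diagonal_Subsequence"
begin

text \<open>Let \<open>X\<close> be singular with respect to \<open>y\<close>. If a connected non-dense \<open>A \<subseteq> X\<close> had interior, then
  \<open>X - A\<close> would either be connected with \<open>y\<close> in its closure or split into two open pieces, one of
  which together with \<open>A\<close> is connected with \<open>y\<close> in its closure; both contradict singularity. So
  such \<open>A\<close> are nowhere dense, hence have closure inside the meager composant \<open>X\<close>, and \<open>X\<close> is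
  \<open>\<sigma>\<close>-compact.

  Let \<open>V\<close> be an open set meeting \<open>X\<close>. If connected subsets of \<open>X - V\<close> converge to \<open>F\<close>
  with \<open>F \<inter> X \<noteq> {}\<close>, then \<open>F\<close> has empty interior, because otherwise almost all of them would have a
  connected union; hence \<open>F \<subseteq> X\<close>. So the components of \<open>X - V\<close> form an upper semicontinuous
  decomposition into continua, and by \<open>\<sigma>\<close>-compactness every neighbourhood of a component contains
  a relatively clopen one. Countably many Urysohn functions for such clopen splittings yield
  a metrizable compactification of \<open>X\<close> in which every proper subcontinuum meeting \<open>X\<close> lies in \<open>X\<close>.
  This compactification is indecomposable, and \<open>X\<close> is one of its composants.\<close>

section \<open>Limits of connected sets\<close>

text \<open>In a separation every \<open>J i\<close> lies on one side and meets \<open>T\<close>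
  there, so \<open>inter\<close> makes almost all later sets meet that side. Both sides being
  occupied, some late set meets both.\<close>

lemma connected_union_of_interlaced:
  assumes conn: "\<And>i. connected (J i)"
    and inter: "\<And>i U. open U \<Longrightarrow> U \<inter> J i \<inter> T \<noteq> {} \<Longrightarrow> eventually (\<lambda>j. U \<inter> J j \<noteq> {}) sequentially"
    and T: "\<And>i. J i \<inter> T \<noteq> {}"
  shows "connected (\<Union>i. J i)"
proof (rule connectedI)
  fix A B assume A: "open A" "A \<inter> (\<Union>i. J i) \<noteq> {}" and B: "open B" "B \<inter> (\<Union>i. J i) \<noteq> {}"
    and AB: "(\<Union>i. J i) \<subseteq> A \<union> B" "A \<inter> B \<inter> (\<Union>i. J i) = {}"
  have dich: "J i \<inter> A = {} \<or> J i \<inter> B = {}" for i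
    using connectedD[OF conn A(1) B(1), of i] AB by blast
  have ev: "eventually (\<lambda>j. C \<inter> J j \<noteq> {}) sequentially"
    if C: "open C" "C \<inter> (\<Union>i. J i) \<noteq> {}" and CD: "\<And>i. J i \<inter> C = {} \<or> J i \<inter> D = {}"
      and cov: "(\<Union>i. J i) \<subseteq> C \<union> D" for C D
  proof -
    obtain i where "C \<inter> J i \<noteq> {}" using C by blast
    then have "J i \<subseteq> C" using CD[of i] cov by blast
    then have "C \<inter> J i \<inter> T \<noteq> {}" using T[of i] by blast
    then show ?thesis using inter[OF C(1)] by blast
  qed
  have "eventually (\<lambda>j. A \<inter> J j \<noteq> {} \<and> B \<inter> J j \<noteq> {}) sequentially"
  proof (rule eventually_conj)
    show "eventually (\<lambda>j. A \<inter> J j \<noteq> {}) sequentially" by (rule ev[OF A dich AB(1)])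
    show "eventually (\<lambda>j. B \<inter> J j \<noteq> {}) sequentially" by (rule ev[OF B, of A]) (use dich AB(1) in auto)
  qed
  then obtain N where "A \<inter> J N \<noteq> {}" "B \<inter> J N \<noteq> {}"
    unfolding eventually_sequentially by blast
  then show False using dich[of N] by blast
qed

text \<open>A diagonal argument over a countable basis: along \<open>r\<close> each basic set is met
  by almost all sets or missed by almost all, so their lower and upper limits coincide.\<close>

lemma hausdorff_limit_subsequence:
  fixes J :: "nat \<Rightarrow> 'a::second_countable_topology set"
  obtains r where "strict_mono r"
    and "\<And>z. (\<forall>U. open U \<longrightarrow> z \<in> U \<longrightarrow> eventually (\<lambda>i. U \<inter> J (r i) \<noteq> {}) sequentially) \<or>
      (\<exists>U. open U \<and> z \<in> U \<and> eventually (\<lambda>i. U \<inter> J (r i) = {}) sequentially)"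
proof -
  obtain \<B> :: "'a set set" where \<B>: "countable \<B>" "topological_basis \<B>"
    using ex_countable_basis by blast
  define B where "B = from_nat_into \<B>"
  have range_B: "range B = \<B>"
    unfolding B_def using \<B> topological_basisE[OF \<B>(2) open_UNIV] by (intro range_from_nat_into) auto
  have B: "\<And>n. open (B n)"
    using range_B topological_basis_open[OF \<B>(2)] by blast
  define P where "P n s \<longleftrightarrow> (\<forall>i. B n \<inter> J (s i) \<noteq> {}) \<or> (\<forall>i. B n \<inter> J (s i) = {})"
    for n and s :: "nat \<Rightarrow> nat"
  interpret subseqs P
  proof
    fix n and s :: "nat \<Rightarrow> nat"
    show "\<exists>r'. strict_mono r' \<and> P n (s \<circ> r')"
    proof (cases "infinite {i. B n \<inter> J (s i) \<noteq> {}}")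
      case True
      then show ?thesis using infinite_enumerate[OF True] unfolding P_def by auto
    next
      case False
      then have inf: "infinite {i. B n \<inter> J (s i) = {}}"
        using finite_Collect_not[of "\<lambda>i. B n \<inter> J (s i) = {}"] by auto
      show ?thesis using infinite_enumerate[OF inf] unfolding P_def by auto
    qed
  qed
  have ev: "eventually (\<lambda>i. B n \<inter> J (diagseq i) \<noteq> {}) sequentially \<or>
            eventually (\<lambda>i. B n \<inter> J (diagseq i) = {}) sequentially" for n
  proof -
    \<comment> \<open>The decision on \<open>B n\<close> is guaranteed only from index
      \<open>Suc n\<close> of the diagonal on, hence the shift.\<close>
    have "P n (diagseq \<circ> ((+) (Suc n)))"
      by (rule diagseq_holds) (auto simp: P_def)
    then have "(\<forall>j. B n \<inter> J (diagseq (Suc n + j)) \<noteq> {}) \<or> (\<forall>j. B n \<inter> J (diagseq (Suc n + j)) = {})"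
      unfolding P_def o_def .
    moreover have "i = Suc n + (i - Suc n)" if "i \<ge> Suc n" for i using that by simp
    ultimately show ?thesis
      unfolding eventually_sequentially by metis
  qed
  show thesis
  proof
    show "strict_mono diagseq" by (rule subseq_diagseq)
    fix z
    show "(\<forall>U. open U \<longrightarrow> z \<in> U \<longrightarrow> eventually (\<lambda>i. U \<inter> J (diagseq i) \<noteq> {}) sequentially) \<or>
      (\<exists>U. open U \<and> z \<in> U \<and> eventually (\<lambda>i. U \<inter> J (diagseq i) = {}) sequentially)"
    proof (cases "\<exists>n. z \<in> B n \<and> eventually (\<lambda>i. B n \<inter> J (diagseq i) = {}) sequentially")
      case True
      then show ?thesis using B by blast
    next
      case False
      have "eventually (\<lambda>i. U \<inter> J (diagseq i) \<noteq> {}) sequentially" if "open U" "z \<in> U" for U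
      proof -
        obtain n where n: "z \<in> B n" "B n \<subseteq> U" 
          using topological_basisE[OF \<B>(2) \<open>open U\<close> \<open>z \<in> U\<close>] range_B by (metis rangeE)
        then have "eventually (\<lambda>i. B n \<inter> J (diagseq i) \<noteq> {}) sequentially" using ev[of n] False by blast
        then show ?thesis by (rule eventually_mono) (use n in auto)
      qed
      then show ?thesis by blast
    qed
  qed
qed

section \<open>Connected subsets of a singular dense meager composant\<close>

text \<open>Here \<open>X\<close> is the meager composant of \<open>x\<close>, singular with respect to \<open>y\<close>. The assumptions
  \<open>absorb\<close> and \<open>reach\<close> are all that the proof needs of meager composants; the premise on \<open>U\<close> in
  \<open>absorb\<close> says that \<open>K\<close> is nowhere dense in \<open>Y\<close>.\<close>

locale singular_dense_subspace =
  fixes Y X :: "'a::{metric_space,second_countable_topology} set" and x y :: 'a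
  assumes compact_Y: "compact Y" and X_subset: "X \<subseteq> Y" and Y_subset: "Y \<subseteq> closure X"
    and y_in: "y \<in> Y" and nontrivial: "\<exists>a\<in>Y. a \<noteq> y"
    and connected_X: "connected X"
    and singular: "\<And>C. C \<subseteq> X \<Longrightarrow> connected C \<Longrightarrow> y \<in> closure C \<Longrightarrow> X \<subseteq> closure C"
    and absorb: "\<And>K. compact K \<Longrightarrow> connected K \<Longrightarrow> K \<subseteq> Y \<Longrightarrow> K \<inter> X \<noteq> {} \<Longrightarrow>
        (\<And>U. open U \<Longrightarrow> U \<inter> Y \<noteq> {} \<Longrightarrow> \<not> U \<inter> Y \<subseteq> K) \<Longrightarrow> K \<subseteq> X"
    and reach: "\<And>p. p \<in> X \<Longrightarrow> \<exists>K. compact K \<and> connected K \<and> K \<subseteq> X \<and> x \<in> K \<and> p \<in> K"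
begin

lemma closed_Y: "closed Y" by (rule compact_imp_closed[OF compact_Y])

lemma closure_X: "closure X = Y"
  by (simp add: X_subset Y_subset closed_Y closure_minimal subset_antisym)

text \<open>Otherwise singularity applies to \<open>{y}\<close>, and \<open>X\<close> and its
  closure \<open>Y\<close> shrink to one point.\<close>

lemma y_notin: "y \<notin> X"
proof
  assume "y \<in> X"
  then have "X \<subseteq> {y}" using singular[of "{y}"] by auto
  then have "Y \<subseteq> {y}" using Y_subset closure_minimal[of X "{y}"] by auto
  then show False using nontrivial by blast
qed

lemma two_points_X: "\<exists>a\<in>X. \<exists>b\<in>X. a \<noteq> b"
proof (rule ccontr)
  assume "\<not> ?thesis"
  then obtain a where "X \<subseteq> {a}" by (cases "X = {}") auto
  then have "closed X" by (metis closed_empty closed_singleton subset_singletonD)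
  then show False using closure_X y_in y_notin by auto
qed

lemma nowhere_dense_of_connected:
  assumes C: "C \<subseteq> X" "connected C" "y \<notin> closure C" and U: "open U" "U \<inter> Y \<noteq> {}"
  shows "\<not> U \<inter> Y \<subseteq> closure C"
proof
  assume sub: "U \<inter> Y \<subseteq> closure C"
  \<comment> \<open>The closure of \<open>C\<close> relative to \<open>X\<close> is still connected
    with \<open>y\<close> outside its closure, and it contains all of
    \<open>U \<inter> X\<close>.\<close>
  define A where "A = closure C \<inter> X"
  have A: "connected A" "A \<subseteq> X"
    using connected_intermediate_closure[OF C(2), of A] C(1) closure_subset A_def by auto
  have UX: "U \<inter> X \<noteq> {}" "U \<inter> X \<subseteq> A"
    using U closure_X open_Int_closure_eq_empty sub X_subset unfolding A_def by blast+
  have clA: "closure A \<subseteq> closure C"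
    by (simp add: A_def closure_minimal)
  have ycl: "y \<in> closure (X - A)"
    using C(3) y_in clA closure_X closure_Un[of A "X - A"] Un_Diff_cancel[of A X] Un_absorb1[OF A(2)] by auto
  \<comment> \<open>A connected enlargement of \<open>A\<close> inside \<open>X\<close> accumulating
    at \<open>y\<close> is dense in \<open>X\<close>, so it cannot avoid an open set meeting
    \<open>X\<close>.\<close>
  have impossible: False if T: "connected (A \<union> T)" "T \<subseteq> X" "y \<in> closure T" and
    V: "open V" "V \<inter> X \<noteq> {}" "V \<inter> (A \<union> T) = {}" for T V
  proof -
    have "y \<in> closure (A \<union> T)" using T by auto
    then have "X \<subseteq> closure (A \<union> T)" using T A by (intro singular) auto
    then show False using V open_Int_closure_eq_empty by blast
  qed
  show False
  proof (cases "connected (X - A)")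
    case True
    then have "X \<subseteq> closure (X - A)" using ycl by (intro singular) auto
    moreover have "U \<inter> (X - A) = {}" using UX by auto
    ultimately show False using UX(1) U(1) open_Int_closure_eq_empty by blast
  next
    case False
    then obtain P Q where PQ: "open P" "open Q" "P \<inter> (X - A) \<noteq> {}" "Q \<inter> (X - A) \<noteq> {}"
       "X - A \<subseteq> P \<union> Q" "P \<inter> Q \<inter> (X - A) = {}" unfolding connected_def by blast
    \<comment> \<open>The piece of \<open>X - A\<close> accumulating at \<open>y\<close> is joined
      to \<open>A\<close>; the part of \<open>Q\<close> outside \<open>closure C\<close> supplies
      the avoided open set.\<close>
    have pw: False if PQ: "open P" "open Q" "P \<inter> (X - A) \<noteq> {}" "Q \<inter> (X - A) \<noteq> {}"
       "X - A \<subseteq> P \<union> Q" "P \<inter> Q \<inter> (X - A) = {}" "y \<in> closure (P \<inter> (X - A))" for P Q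
    proof (rule impossible)
      have op: "openin (top_of_set (X - A)) (P \<inter> (X - A))" using PQ(1)
        by (metis Int_commute openin_open_Int)
      have "openin (top_of_set (X - A)) (Q \<inter> (X - A))" using PQ(2)
        by (metis Int_commute openin_open_Int)
      moreover have "P \<inter> (X - A) = (X - A) - Q \<inter> (X - A)" using PQ by auto
      ultimately have cl: "closedin (top_of_set (X - A)) (P \<inter> (X - A))" 
        by (metis closedin_diff closedin_topspace topspace_euclidean_subtopology)
      show "connected (A \<union> P \<inter> (X - A))"
        using connected_Un_clopen_in_complement[OF A(1) connected_X A(2) op cl] .
      show "open (Q - closure C)" using PQ(2) by auto
      show "(Q - closure C) \<inter> X \<noteq> {}" using PQ(4) unfolding A_def by auto
      show "(Q - closure C) \<inter> (A \<union> P \<inter> (X - A)) = {}" using PQ(6) unfolding A_def by auto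
    qed (use PQ in auto)
    have "X - A = P \<inter> (X - A) \<union> Q \<inter> (X - A)" using PQ by auto
    then have "y \<in> closure (P \<inter> (X - A)) \<or> y \<in> closure (Q \<inter> (X - A))"
      using ycl closure_Un by (metis Un_iff)
    then show False using pw[of P Q] pw[of Q P] PQ by blast
  qed
qed

text \<open>For nonempty \<open>C\<close>, the closure is a compact connected set meeting
  \<open>X\<close>, with empty interior in \<open>Y\<close> by the preceding lemma, so
  \<open>absorb\<close> applies.\<close>

lemma closure_connected_subset:
  assumes C: "C \<subseteq> X" "connected C" "y \<notin> closure C"
  shows "closure C \<subseteq> X"
proof (cases "C = {}")
  case False
  have "closure C \<subseteq> Y" using C closure_X closure_mono by blast
  then show ?thesis
    using C False nowhere_dense_of_connected[OF C] closure_subset[of C]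
      compact_Int_closed[OF compact_Y, of "closure C"] connected_imp_connected_closure[OF C(2)]
    by (intro absorb) (auto simp: Int_absorb1)
qed auto

text \<open>The continua in \<open>X\<close> through \<open>x\<close> that avoid a fixed ball around
  \<open>y\<close> have a connected union, whose closure is a compact subset of \<open>X\<close>.
  Each continua from \<open>reach\<close> misses \<open>y\<close>, hence some ball of radius
  \<open>inverse (Suc n)\<close>.\<close>

lemma subset_X_sigma_compact:
  "\<exists>L :: nat \<Rightarrow> 'a set. (\<forall>n. compact (L n)) \<and> X = (\<Union>n. L n)"
proof -
  define G where "G n = \<Union>{K. compact K \<and> connected K \<and> K \<subseteq> X \<and> x \<in> K \<and> K \<inter> ball y (inverse (Suc n)) = {}}" for n
  have G: "G n \<subseteq> X" "connected (G n)" for n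
    unfolding G_def by (auto intro!: connected_Union)
  have yG: "y \<notin> closure (G n)" for n
  proof -
    have "G n \<inter> ball y (inverse (Suc n)) = {}" unfolding G_def by auto
    then show ?thesis unfolding closure_iff_nhds_not_empty
      by (metis Int_commute centre_in_ball inverse_positive_iff_positive of_nat_0_less_iff open_ball subset_refl zero_less_Suc)
  qed
  have "closure (G n) \<subseteq> X" for n using closure_connected_subset[OF G yG] .
  moreover have "p \<in> (\<Union>n. closure (G n))" if p: "p \<in> X" for p
  proof -
    obtain K where K: "compact K" "connected K" "K \<subseteq> X" "x \<in> K" "p \<in> K" using reach[OF p] by blast
    have "open (- K)" "y \<in> - K" using K y_notin compact_imp_closed by auto
    then obtain e where e: "e > 0" "ball y e \<subseteq> - K" by (meson open_contains_ball)
    obtain n where "inverse (real (Suc n)) < e" using reals_Archimedean e by blast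
    then have "K \<inter> ball y (inverse (Suc n)) = {}" using e(2)
      by (meson disjoint_iff ComplD subsetD less_imp_le subset_ball)
    then have "p \<in> G n" using K unfolding G_def by blast
    then show ?thesis using closure_subset by blast
  qed
  moreover have "compact (closure (G n))" for n
    using compact_Int_closed[OF compact_Y, of "closure (G n)"] calculation(1)[of n] X_subset
    by (simp add: Int_absorb1 inf.absorb2 subset_trans)
  ultimately show ?thesis by (intro exI[of _ "\<lambda>n. closure (G n)"]) blast
qed

text \<open>Upper semicontinuity of the components of \<open>X - V\<close>.\<close>

lemma limit_of_connected:
  assumes V: "open V" "V \<inter> X \<noteq> {}"
    and J: "\<And>i :: nat. J i \<subseteq> X - V" "\<And>i. connected (J i)"
    and a: "\<And>i. a i \<in> J i" "a \<longlonglongrightarrow> a'" "a' \<in> X" and b: "\<And>i. b i \<in> J i" "b \<longlonglongrightarrow> b'"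
  obtains C where "connected C" "C \<subseteq> X - V" "a' \<in> C" "b' \<in> C"
proof -
  \<comment> \<open>Pass to a subsequence with a set limit; \<open>F\<close> below is this limit and
    contains \<open>a'\<close> and \<open>b'\<close>.\<close>
  obtain r where r: "strict_mono r"
    and dich: "\<And>z. (\<forall>U. open U \<longrightarrow> z \<in> U \<longrightarrow> eventually (\<lambda>i. U \<inter> J (r i) \<noteq> {}) sequentially) \<or>
      (\<exists>U. open U \<and> z \<in> U \<and> eventually (\<lambda>i. U \<inter> J (r i) = {}) sequentially)"
    using hausdorff_limit_subsequence[of J] by blast
  define F where "F = {z. \<forall>U. open U \<longrightarrow> z \<in> U \<longrightarrow> eventually (\<lambda>i. U \<inter> J (r i) \<noteq> {}) sequentially}"
  have FD: "eventually (\<lambda>i. U \<inter> J (r i) \<noteq> {}) sequentially" if "z \<in> F" "open U" "z \<in> U" for z U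
    using that unfolding F_def by blast
  have notF: "\<exists>U. open U \<and> z \<in> U \<and> eventually (\<lambda>i. U \<inter> J (r i) = {}) sequentially" if "z \<notin> F" for z
    using that dich[of z] unfolding F_def by blast
  have clash: False if "eventually (\<lambda>i. U \<inter> J (r i) \<noteq> {}) sequentially" "eventually (\<lambda>i. U \<inter> J (r i) = {}) sequentially" for U
    using eventually_conj[OF that] by simp
  have "open (- F)"
  proof (subst open_subopen, intro ballI)
    fix z assume "z \<in> - F"
    then obtain U where U: "open U" "z \<in> U" "eventually (\<lambda>i. U \<inter> J (r i) = {}) sequentially" using notF by blast
    then have "U \<subseteq> - F" using FD clash by blast
    then show "\<exists>T. open T \<and> z \<in> T \<and> T \<subseteq> - F" using U by blast
  qed
  then have closedF: "closed F" by (simp add: closed_def)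
  have JY: "J i \<subseteq> Y - V" for i using J(1) X_subset by blast
  have FY: "F \<subseteq> Y - V"
  proof
    fix z assume z: "z \<in> F"
    show "z \<in> Y - V"
    proof (rule ccontr)
      assume "z \<notin> Y - V"
      then have "eventually (\<lambda>i. (- Y \<union> V) \<inter> J (r i) \<noteq> {}) sequentially"
        using z closed_Y V by (intro FD[of z]) auto
      then obtain i where "(- Y \<union> V) \<inter> J (r i) \<noteq> {}" unfolding eventually_sequentially by blast
      then show False using JY[of "r i"] by blast
    qed
  qed
  have compactF: "compact F"
    using compact_Int_closed[OF compact_Y closedF] FY by (metis Diff_subset Int_absorb1 subset_trans)
  have limF: "c' \<in> F" if "\<And>i. c i \<in> J i" "c \<longlonglongrightarrow> c'" for c c'
    unfolding F_def
  proof (intro CollectI allI impI)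
    fix U assume "open U" "c' \<in> U"
    moreover have "(c \<circ> r) \<longlonglongrightarrow> c'" using LIMSEQ_subseq_LIMSEQ[OF that(2) r] .
    ultimately have "eventually (\<lambda>i. c (r i) \<in> U) sequentially" using topological_tendstoD by fastforce
    then show "eventually (\<lambda>i. U \<inter> J (r i) \<noteq> {}) sequentially" by (rule eventually_mono) (use that in blast)
  qed
  have aF: "a' \<in> F" and bF: "b' \<in> F" using limF[OF a(1,2)] limF[OF b] by auto
  \<comment> \<open>The compact remainder \<open>R\<close> misses \<open>F\<close>, so it is covered
    by finitely many open sets, each missed by almost all \<open>J (r i)\<close>. A late set then
    lies in \<open>P \<union> Q\<close> and meets both.\<close>
  have split: False if AB: "closed A" "closed B" "a' \<in> A" "B \<noteq> {}" "A \<union> B = F" "A \<inter> B = {}" for A B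
  proof -
    obtain P Q where PQ: "open P" "open Q" "A \<subseteq> P" "B \<subseteq> Q" "P \<inter> Q = {}"
      using t4_space[OF AB(1,2,6)] by metis
    define R where "R = Y - (P \<union> Q)"
    have "compact R" unfolding R_def using compact_Y PQ by (simp add: compact_diff open_Un)
    moreover have "R \<subseteq> \<Union>{U. open U \<and> eventually (\<lambda>i. U \<inter> J (r i) = {}) sequentially}"
    proof
      fix z assume "z \<in> R"
      then have "z \<notin> F" using AB PQ unfolding R_def by blast
      then show "z \<in> \<Union>{U. open U \<and> eventually (\<lambda>i. U \<inter> J (r i) = {}) sequentially}" using notF by blast
    qed
    ultimately obtain \<U> where \<U>: "\<U> \<subseteq> {U. open U \<and> eventually (\<lambda>i. U \<inter> J (r i) = {}) sequentially}"
       "finite \<U>" "R \<subseteq> \<Union>\<U>"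
      using compactE[of R] by (metis (no_types, lifting) mem_Collect_eq)
    have "eventually (\<lambda>i. \<forall>U\<in>\<U>. U \<inter> J (r i) = {}) sequentially"
      using \<U> by (intro eventually_ball_finite) auto
    moreover have "eventually (\<lambda>i. P \<inter> J (r i) \<noteq> {}) sequentially" using FD[OF aF PQ(1)] AB PQ by blast
    moreover have "eventually (\<lambda>i. Q \<inter> J (r i) \<noteq> {}) sequentially" using FD[OF _ PQ(2)] AB PQ by blast
    ultimately have "eventually (\<lambda>i. (\<forall>U\<in>\<U>. U \<inter> J (r i) = {}) \<and> P \<inter> J (r i) \<noteq> {} \<and> Q \<inter> J (r i) \<noteq> {}) sequentially"
      by (intro eventually_conj)
    then obtain i where i: "\<forall>U\<in>\<U>. U \<inter> J (r i) = {}" "P \<inter> J (r i) \<noteq> {}" "Q \<inter> J (r i) \<noteq> {}"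
      unfolding eventually_sequentially by blast
    have "J (r i) \<inter> R = {}" using i(1) \<U>(3) by blast
    then have "J (r i) \<subseteq> P \<union> Q" using JY unfolding R_def by blast
    then show False using connectedD[OF J(2)[of "r i"] PQ(1,2)] PQ(5) i by blast
  qed
  have connF: "connected F"
  proof (rule ccontr)
    assume "\<not> connected F"
    then obtain A B where AB: "closed A" "closed B" "A \<noteq> {}" "B \<noteq> {}" "A \<union> B = F" "A \<inter> B = {}"
      using connected_closed_set[OF closedF] by blast
    then have "a' \<in> A \<or> a' \<in> B" using aF by blast
    then show False using split[of A B] split[of B A] AB by blast
  qed
  \<comment> \<open>If \<open>F\<close> had interior, the union \<open>G\<close> of a tail of the
    sets would be connected, avoid \<open>V\<close> and have that interior in its closure, which
    \<open>nowhere_dense_of_connected\<close> forbids.\<close>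
  have "F \<subseteq> X"
  proof (rule absorb[OF compactF connF])
    show "F \<subseteq> Y" "F \<inter> X \<noteq> {}" using FY aF a by auto
    fix U assume U: "open U" "U \<inter> Y \<noteq> {}"
    show "\<not> U \<inter> Y \<subseteq> F"
    proof
      assume sub: "U \<inter> Y \<subseteq> F"
      obtain z0 where "z0 \<in> U" "z0 \<in> Y" using U(2) by blast
      then have "eventually (\<lambda>i. U \<inter> J (r i) \<noteq> {}) sequentially" using FD[of z0 U] U(1) sub by blast
      then obtain N where N: "\<And>i. i \<ge> N \<Longrightarrow> U \<inter> J (r i) \<noteq> {}"
        unfolding eventually_sequentially by blast
      \<comment> \<open>Each point of \<open>U \<inter> Y\<close> is a limit of these sets, and each of them meets \<open>U\<close>; so the union cannot be split.\<close>
      define G where "G = (\<Union>i. J (r (N + i)))"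
      have "connected G" unfolding G_def
      proof (rule connected_union_of_interlaced[where T=U])
        fix i W assume W: "open W" "W \<inter> J (r (N + i)) \<inter> U \<noteq> {}"
        then obtain z where "z \<in> W" "z \<in> F" using sub JY by blast
        then have "eventually (\<lambda>j. W \<inter> J (r j) \<noteq> {}) sequentially" using FD W by blast
        then show "eventually (\<lambda>j. W \<inter> J (r (N + j)) \<noteq> {}) sequentially"
          using eventually_sequentially_seg[of "\<lambda>j. W \<inter> J (r j) \<noteq> {}" N] by (simp add: add.commute)
      qed (use J N in \<open>auto simp: Int_commute\<close>)
      have GX: "G \<subseteq> X - V" unfolding G_def using J by blast
      have "y \<notin> closure G"
      proof
        assume "y \<in> closure G"
        then have "X \<subseteq> closure G" using \<open>connected G\<close> GX by (intro singular) auto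
        then show False using GX V open_Int_closure_eq_empty[of V G] by blast
      qed
      then have "\<not> U \<inter> Y \<subseteq> closure G" using GX U \<open>connected G\<close> by (intro nowhere_dense_of_connected) auto
      moreover have "F \<subseteq> closure G"
      proof
        fix z assume z: "z \<in> F"
        show "z \<in> closure G" unfolding closure_iff_nhds_not_empty
        proof (intro allI impI)
          fix A W assume "W \<subseteq> A" "open W" "z \<in> W"
          then obtain M where "\<And>i. i \<ge> M \<Longrightarrow> W \<inter> J (r i) \<noteq> {}"
            using FD[OF z] unfolding eventually_sequentially by blast
          then have "W \<inter> J (r (N + M)) \<noteq> {}" by simp
          then show "G \<inter> A \<noteq> {}" using \<open>W \<subseteq> A\<close> unfolding G_def by blast
        qed
      qed
      ultimately show False using sub by blast
    qed
  qed
  then show thesis using that connF FY aF bF by blast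
qed

section \<open>Clopen neighbourhoods of components\<close>

text \<open>Equivalently, some component of \<open>X - V\<close> meets both sets. These may be
  arbitrary ambient sets, so that closures of open sets can be compared.\<close>

definition linked :: "'a set \<Rightarrow> 'a set \<Rightarrow> 'a set \<Rightarrow> bool" where
  "linked V P Q \<longleftrightarrow> (\<exists>C. connected C \<and> C \<subseteq> X - V \<and> C \<inter> P \<noteq> {} \<and> C \<inter> Q \<noteq> {})"

lemma linked_commute: "linked V P Q \<longleftrightarrow> linked V Q P"
  unfolding linked_def by blast

lemma linked_Un_left: "linked V (P \<union> P') Q \<longleftrightarrow> linked V P Q \<or> linked V P' Q"
  unfolding linked_def by blast

lemma linked_Un_right: "linked V P (Q \<union> Q') \<longleftrightarrow> linked V P Q \<or> linked V P Q'"
  unfolding linked_def by blast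

lemma linked_refl: "q \<in> X - V \<Longrightarrow> q \<in> P \<Longrightarrow> q \<in> Q \<Longrightarrow> linked V P Q"
  unfolding linked_def by (intro exI[of _ "{q}"]) auto

text \<open>If all closed neighbourhoods of \<open>S\<close> were linked to \<open>T\<close>, the
  endpoints of the links would subconverge to a point of \<open>S\<close>, hence of
  \<open>X\<close>, and a point of \<open>T\<close>; \<open>limit_of_connected\<close> then links
  \<open>S\<close> to \<open>T\<close>.\<close>

lemma unlinked_neighborhood:
  assumes V: "open V" "V \<inter> X \<noteq> {}" and S: "compact S" "S \<subseteq> X" and T: "closed T"
    and un: "\<not> linked V S T"
  obtains P where "open P" "S \<subseteq> P" "\<not> linked V (closure P) T"
\<comment> \<open>\<open>infdist\<close> to the empty set is 0 by convention, so the sets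
  \<open>P n\<close> below are useless in this case.\<close>
proof (cases "S = {}")
  case True
  then show ?thesis using that[of "{}"] by (auto simp: linked_def)
next
  case False
  define P where "P n = {z. infdist z S < inverse (real (Suc n))}" for n
  have openP: "open (P n)" for n
    unfolding P_def by (intro open_Collect_less continuous_intros)
  have SP: "S \<subseteq> P n" for n by (auto simp: P_def infdist_zero)
  have clP: "closure (P n) \<subseteq> {z. infdist z S \<le> inverse (real (Suc n))}" for n
    by (intro closure_minimal closed_Collect_le continuous_intros) (auto simp: P_def)
  show ?thesis
  proof (rule ccontr)
    assume "\<not> thesis"
    then have "\<forall>n. linked V (closure (P n)) T" using that openP SP by blast
    then obtain C a b where C: "\<And>n. connected (C n)" "\<And>n. C n \<subseteq> X - V"
      "\<And>n. a n \<in> C n" "\<And>n. a n \<in> closure (P n)" "\<And>n. b n \<in> C n" "\<And>n. b n \<in> T"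
      unfolding linked_def disjoint_iff by metis
    have "seq_compact (Y \<times> Y)" using compact_Y compact_Times compact_imp_seq_compact by blast
    moreover have "\<forall>n. (a n, b n) \<in> Y \<times> Y" using C X_subset by blast
    ultimately obtain l r where r: "strict_mono r" "((\<lambda>n. (a n, b n)) \<circ> r) \<longlonglongrightarrow> l"
      by (rule seq_compactE)
    have lim: "(a \<circ> r) \<longlonglongrightarrow> fst l" "(b \<circ> r) \<longlonglongrightarrow> snd l"
      using tendsto_fst[OF r(2)] tendsto_snd[OF r(2)] by (auto simp: o_def)
    have bT: "snd l \<in> T"
      using closed_sequentially[OF T _ lim(2)] C by auto
    have "(\<lambda>n. infdist ((a \<circ> r) n) S) \<longlonglongrightarrow> infdist (fst l) S"
      by (intro tendsto_infdist lim)
    moreover have "(\<lambda>n. infdist ((a \<circ> r) n) S) \<longlonglongrightarrow> 0"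
    proof (rule tendsto_sandwich[OF _ _ tendsto_const])
      show "((\<lambda>n. inverse (real (Suc n))) \<circ> r) \<longlonglongrightarrow> 0"
        using LIMSEQ_inverse_real_of_nat r(1) by (rule LIMSEQ_subseq_LIMSEQ)
      show "\<forall>\<^sub>F n in sequentially. infdist ((a \<circ> r) n) S \<le> ((\<lambda>n. inverse (real (Suc n))) \<circ> r) n"
        using C(4) clP by (auto intro!: always_eventually)
    qed (auto simp: infdist_nonneg)
    ultimately have "infdist (fst l) S = 0" by (rule LIMSEQ_unique)
    then have aS: "fst l \<in> S" using in_closed_iff_infdist_zero[OF compact_imp_closed[OF S(1)] False] by blast
    obtain D where "connected D" "D \<subseteq> X - V" "fst l \<in> D" "snd l \<in> D"
      by (rule limit_of_connected[OF V, of "C \<circ> r" "a \<circ> r" "fst l" "b \<circ> r" "snd l"])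
        (use C lim aS S in auto)
    then show False using un aS bT unfolding linked_def by blast
  qed
qed

text \<open>This is the union of the components of \<open>X - V\<close> meeting \<open>M\<close>. It
  is closed: the partners in \<open>M\<close> of a convergent sequence subconverge in
  \<open>M\<close>, and \<open>limit_of_connected\<close> links the two limits.\<close>

lemma compact_saturation:
  assumes V: "open V" "V \<inter> X \<noteq> {}" and M: "compact M" "M \<subseteq> X - V"
  shows "compact {z. linked V {z} M}"
proof -
  have sub: "{z. linked V {z} M} \<subseteq> X" unfolding linked_def by blast
  have "closed {z. linked V {z} M}"
    unfolding closed_sequential_limits
  proof (intro allI impI, elim conjE)
    fix z l assume "\<forall>n. z n \<in> {z. linked V {z} M}" and l: "z \<longlonglongrightarrow> l"
    then obtain C m where C: "\<And>n. connected (C n)" "\<And>n. C n \<subseteq> X - V"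
      "\<And>n. z n \<in> C n" "\<And>n. m n \<in> C n" "\<And>n::nat. m n \<in> M"
      unfolding linked_def disjoint_iff mem_Collect_eq by (metis singletonD)
    obtain m' r where r: "m' \<in> M" "strict_mono r" "(m \<circ> r) \<longlonglongrightarrow> m'"
      using M(1) C(5) by (metis compact_imp_seq_compact seq_compactE)
    obtain D where "connected D" "D \<subseteq> X - V" "m' \<in> D" "l \<in> D"
      by (rule limit_of_connected[OF V, of "C \<circ> r" "m \<circ> r" m' "z \<circ> r" l])
        (use C r M LIMSEQ_subseq_LIMSEQ[OF l r(2)] in auto)
    then show "l \<in> {z. linked V {z} M}" using r unfolding linked_def by blast
  qed
  then show ?thesis using compact_Int_closed[OF compact_Y] sub X_subset
    by (metis Int_absorb1 subset_trans)
qed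

text \<open>By \<open>sat\<close>, \<open>B\<close> is a union of components of
  \<open>X - V\<close>, none of which meets both closures. Compactness cuts \<open>B\<close> into
  two relatively clopen pieces, which are then thickened without creating a link.\<close>

lemma separation_step:
  assumes V: "open V" "V \<inter> X \<noteq> {}" and B: "compact B" "B \<subseteq> X - V"
    and sat: "\<And>C. connected C \<Longrightarrow> C \<subseteq> X - V \<Longrightarrow> C \<inter> B \<noteq> {} \<Longrightarrow> C \<subseteq> B"
    and PQ: "open P" "open Q" "\<not> linked V (closure P) (closure Q)"
  obtains P' Q' where "open P'" "open Q'" "\<not> linked V (closure P') (closure Q')"
    "P \<subseteq> P'" "Q \<subseteq> Q'" "B \<subseteq> P' \<union> Q'"
proof -
  have "separated_between (top_of_set B) (B \<inter> closure P) (B \<inter> closure Q)"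
  proof (rule cut_wire_fence_theorem)
    show "disjnt C (B \<inter> closure P) \<or> disjnt C (B \<inter> closure Q)" if "connectedin (top_of_set B) C" for C
      using that PQ(3) B(2) unfolding linked_def disjnt_def by (auto simp: connectedin_subtopology)
  qed (use B(1) in \<open>auto simp: compact_space_subtopology Hausdorff_space_subtopology closedin_closed_Int\<close>)
  then obtain S T where ST: "openin (top_of_set B) S" "openin (top_of_set B) T" "S \<union> T = B" "S \<inter> T = {}"
    "B \<inter> closure P \<subseteq> S" "B \<inter> closure Q \<subseteq> T"
    unfolding separated_between_def disjnt_def by auto
  have "closedin (top_of_set B) S" "closedin (top_of_set B) T"
  proof -
    have "S = B - T" "T = B - S" using ST by auto
    then show "closedin (top_of_set B) S" "closedin (top_of_set B) T"
      using ST(1,2) by (metis closedin_diff closedin_topspace topspace_euclidean_subtopology)+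
  qed
  then have cS: "compact S" and cT: "compact T" using B(1) closedin_compact by blast+
  have "T \<subseteq> X" using ST B by blast
  have whole: "C \<subseteq> S \<or> C \<subseteq> T" if C: "connected C" "C \<subseteq> X - V" "C \<inter> B \<noteq> {}" for C
  proof -
    obtain U W where "open U" "open W" "S = B \<inter> U" "T = B \<inter> W" using ST(1,2) openin_open by metis
    then show ?thesis using connectedD[OF C(1), of U W] sat[OF C] ST(3,4) by blast
  qed
  have dis1: "\<not> linked V S (T \<union> closure Q)"
    using whole ST unfolding linked_def by blast
  have dis2: "\<not> linked V (closure P) T"
    using whole ST unfolding linked_def by blast
  \<comment> \<open>\<open>P1\<close> is chosen against \<open>T\<close> and
    \<open>closure Q\<close>, then \<open>Q1\<close> against \<open>closure P\<close> and
    \<open>closure P1\<close>; with \<open>PQ\<close> this settles all four pairs.\<close>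
  obtain P1 where P1: "open P1" "S \<subseteq> P1" "\<not> linked V (closure P1) (T \<union> closure Q)"
    by (rule unlinked_neighborhood[OF V cS _ _ dis1])
      (use ST B cT in \<open>auto intro: compact_imp_closed closed_Un\<close>)
  have "\<not> linked V T (closure P \<union> closure P1)"
    using dis2 P1(3) linked_commute linked_Un_left linked_Un_right by blast
  then obtain Q1 where Q1: "open Q1" "T \<subseteq> Q1" "\<not> linked V (closure Q1) (closure P \<union> closure P1)"
    using unlinked_neighborhood[OF V cT \<open>T \<subseteq> X\<close> closed_Un[OF closed_closure closed_closure]] by blast
  show thesis
  proof
    show "\<not> linked V (closure (P \<union> P1)) (closure (Q \<union> Q1))"
      using Q1(3) P1(3) PQ(3) linked_commute linked_Un_left linked_Un_right closure_Un by metis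
  qed (use PQ P1 Q1 ST in auto)
qed

text \<open>\<open>X - V\<close> need not be compact, but \<sigma>-compactness of \<open>X\<close>
  exhausts it by compact saturated sets, each handled by one \<open>separation_step\<close>.\<close>

lemma component_separation:
  assumes V: "open V" "V \<inter> X \<noteq> {}" and p: "p \<in> X - V"
    and N: "open N" "connected_component_set (X - V) p \<subseteq> N"
  obtains P Q where "open P" "open Q" "X - V \<subseteq> P \<union> Q" "P \<inter> Q \<inter> (X - V) = {}"
    "connected_component_set (X - V) p \<subseteq> P" "P \<inter> (X - V) \<subseteq> N"
proof -
  define K where "K = connected_component_set (X - V) p"
  have Kp: "K = {z. linked V {z} {p}}"
    unfolding K_def linked_def connected_component_def by auto
  have cK: "compact K" unfolding Kp by (rule compact_saturation[OF V]) (use p in auto)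
  have KX: "K \<subseteq> X" using connected_component_subset[of "X - V" p] K_def by auto
  obtain N' where N': "open N'" "K \<subseteq> N'" "closure N' \<subseteq> N"
  proof -
    obtain U W where "open U" "open W" "K \<subseteq> U" "- N \<subseteq> W" "U \<inter> W = {}"
      using t4_space[of K "- N"] compact_imp_closed[OF cK] closed_Compl[OF N(1)] N(2) unfolding K_def[symmetric]
      by (metis disjoint_eq_subset_Compl double_complement)
    moreover have "closure U \<subseteq> - W" using calculation by (intro closure_minimal) auto
    ultimately show thesis using that by blast
  qed
  have "\<not> linked V K (- N')"
  proof
    assume "linked V K (- N')"
    then obtain C k q where C: "connected C" "C \<subseteq> X - V" "k \<in> C" "k \<in> K" "q \<in> C" "q \<notin> N'"
      unfolding linked_def by blast
    then have "C \<subseteq> K" unfolding K_def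
      by (metis connected_component_eq connected_component_maximal)
    then show False using C N' by blast
  qed
  then obtain P0 where P0: "open P0" "K \<subseteq> P0" "\<not> linked V (closure P0) (- N')"
    using unlinked_neighborhood[OF V cK KX, of "- N'"] N' by (auto simp: closed_Compl)
  \<comment> \<open>Complementing \<open>closure N'\<close> keeps \<open>closure Q0\<close> outside
    \<open>N'\<close>, hence unlinked from \<open>closure P0\<close>, while \<open>Q0\<close> still
    contains \<open>- N\<close>.\<close>
  define Q0 where "Q0 = - closure N'"
  have Q0: "open Q0" "closure Q0 \<subseteq> - N'" "- N \<subseteq> Q0"
  proof -
    show "closure Q0 \<subseteq> - N'" unfolding Q0_def
      by (intro closure_minimal closed_Compl N') (use closure_subset in auto)
  qed (use N' in \<open>auto simp: Q0_def\<close>)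
  have un0: "\<not> linked V (closure P0) (closure Q0)"
    using P0(3) Q0(2) unfolding linked_def by blast
  obtain L :: "nat \<Rightarrow> 'a set" where L: "\<And>n. compact (L n)" "X = (\<Union>n. L n)"
    using subset_X_sigma_compact by blast
  define B where "B n = {z. linked V {z} (L n - V)}" for n
  have BX: "B n \<subseteq> X - V" for n unfolding B_def linked_def by blast
  have cB: "compact (B n)" for n unfolding B_def
    by (rule compact_saturation[OF V]) (use L V in \<open>auto intro: compact_diff\<close>)
  have satB: "C \<subseteq> B n" if C: "connected C" "C \<subseteq> X - V" "C \<inter> B n \<noteq> {}" for C n
  proof -
    obtain z D where z: "z \<in> C" "connected D" "D \<subseteq> X - V" "z \<in> D" "D \<inter> (L n - V) \<noteq> {}"
      using C(3) unfolding B_def linked_def by blast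
    then have "connected (C \<union> D)" using C by (intro connected_Un) auto
    then show ?thesis unfolding B_def linked_def using z C by blast
  qed
  have covB: "X - V \<subseteq> (\<Union>n. B n)"
  proof
    fix q assume "q \<in> X - V"
    then obtain n where "q \<in> L n - V" using L by blast
    then have "q \<in> B n" unfolding B_def using linked_refl[of q V "{q}" "L n - V"] \<open>q \<in> X - V\<close> by blast
    then show "q \<in> (\<Union>n. B n)" by blast
  qed
  \<comment> \<open>Enlarge unlinked open sets step by step until they cover each \<open>B n\<close>; starting with \<open>Q0 \<supseteq> - N\<close>
      keeps the final \<open>P\<close> inside \<open>N\<close>.\<close>
  define good where "good s \<longleftrightarrow> open (fst s) \<and> open (snd s) \<and> \<not> linked V (closure (fst s)) (closure (snd s))
     \<and> P0 \<subseteq> fst s \<and> Q0 \<subseteq> snd s" for s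
  have "\<exists>f. \<forall>n. good (f n) \<and>
     (fst (f n) \<subseteq> fst (f (Suc n)) \<and> snd (f n) \<subseteq> snd (f (Suc n)) \<and> B n \<subseteq> fst (f (Suc n)) \<union> snd (f (Suc n)))"
  proof (rule dependent_nat_choice)
    show "\<exists>s. good s" using P0 Q0 un0 unfolding good_def by (intro exI[of _ "(P0, Q0)"]) auto
    fix s n assume s: "good s"
    obtain P' Q' where "open P'" "open Q'" "\<not> linked V (closure P') (closure Q')"
      "fst s \<subseteq> P'" "snd s \<subseteq> Q'" "B n \<subseteq> P' \<union> Q'"
      by (rule separation_step[OF V cB[of n] BX[of n] satB[of _ n], of "fst s" "snd s"]) (use s in \<open>auto simp: good_def\<close>)
    then show "\<exists>t. good t \<and> fst s \<subseteq> fst t \<and> snd s \<subseteq> snd t \<and> B n \<subseteq> fst t \<union> snd t"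
      using s unfolding good_def by (intro exI[of _ "(P', Q')"]) auto
  qed
  then obtain f where f: "\<And>n. good (f n)" "\<And>n. fst (f n) \<subseteq> fst (f (Suc n))"
     "\<And>n. snd (f n) \<subseteq> snd (f (Suc n))" "\<And>n. B n \<subseteq> fst (f (Suc n)) \<union> snd (f (Suc n))" by metis
  have mono: "fst (f m) \<subseteq> fst (f n)" "snd (f m) \<subseteq> snd (f n)" if "m \<le> n" for m n
    using lift_Suc_mono_le[of "\<lambda>n. fst (f n)" m n] lift_Suc_mono_le[of "\<lambda>n. snd (f n)" m n] f that by auto
  define P Q where "P = (\<Union>n. fst (f n))" and "Q = (\<Union>n. snd (f n))"
  \<comment> \<open>A common point would lie in both members of a late pair and link them by
    itself.\<close>
  have disj: "P \<inter> Q \<inter> (X - V) = {}"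
  proof (rule ccontr)
    assume "P \<inter> Q \<inter> (X - V) \<noteq> {}"
    then obtain q m n where "q \<in> X - V" "q \<in> fst (f m)" "q \<in> snd (f n)" unfolding P_def Q_def by blast
    then have "q \<in> X - V" "q \<in> fst (f (max m n))" "q \<in> snd (f (max m n))"
      using mono[of m "max m n"] mono[of n "max m n"] by auto
    then have "linked V (closure (fst (f (max m n)))) (closure (snd (f (max m n))))"
      using linked_refl closure_subset by blast
    then show False using f(1) unfolding good_def by blast
  qed
  show thesis
  proof
    show "open P" "open Q" using f(1) unfolding P_def Q_def good_def by auto
    show "X - V \<subseteq> P \<union> Q" using covB f(4) unfolding P_def Q_def by fastforce
    show "P \<inter> Q \<inter> (X - V) = {}" by (rule disj)
    show "connected_component_set (X - V) p \<subseteq> P"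
      using P0 f(1)[of 0] unfolding P_def good_def K_def by blast
    show "P \<inter> (X - V) \<subseteq> N"
      using disj Q0(3) f(1)[of 0] unfolding Q_def good_def by blast
  qed
qed

end

section \<open>The compactification\<close>

text \<open>With a countable basis only countably many unions \<open>\<Union>A\<close> occur, so
  neighbourhoods of compact components can be taken from a countable family.\<close>

lemma compact_subset_finite_Union_basis:
  assumes B: "topological_basis \<B>" and K: "compact K" "K \<subseteq> U" "open U"
  obtains A where "finite A" "A \<subseteq> \<B>" "K \<subseteq> \<Union>A" "\<Union>A \<subseteq> U"
proof -
  have "K \<subseteq> \<Union>{V \<in> \<B>. V \<subseteq> U}"
  proof
    fix z assume "z \<in> K"
    then obtain V where "V \<in> \<B>" "z \<in> V" "V \<subseteq> U" using topological_basisE[OF B K(3)] K(2) by blast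
    then show "z \<in> \<Union>{V \<in> \<B>. V \<subseteq> U}" by blast
  qed
  then obtain A where "A \<subseteq> {V \<in> \<B>. V \<subseteq> U}" "finite A" "K \<subseteq> \<Union>A"
    using compactE[OF K(1), of "{V \<in> \<B>. V \<subseteq> U}"] topological_basis_open[OF B]
    by (metis (no_types, lifting) mem_Collect_eq)
  then show thesis using that by blast
qed

section \<open>Countably many separating functions\<close>

context singular_dense_subspace
begin

lemma compact_component:
  assumes V: "open V" "V \<inter> X \<noteq> {}" and p: "p \<in> X - V"
  shows "compact (connected_component_set (X - V) p)"
proof -
  have "connected_component_set (X - V) p = {z. linked V {z} {p}}"
    unfolding linked_def connected_component_def by auto
  then show ?thesis using compact_saturation[OF V, of "{p}"] p by simp
qed

text \<open>Off \<open>V\<close>, \<open>g\<close> encodes a relatively clopen splitting of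
  \<open>X - V\<close>. The set \<open>B\<close> replaces the point to be separated, so that the
  triples can run through a countable set.\<close>

definition separator :: "'a set \<times> 'a set \<times> 'a set \<Rightarrow> ('a \<Rightarrow> real) \<Rightarrow> bool" where
  "separator t g \<longleftrightarrow> (case t of (V, B, N) \<Rightarrow>
     continuous_on X g \<and> g ` X \<subseteq> {0..1} \<and> g ` (X - V) \<subseteq> {0, 1} \<and> (\<forall>z\<in>X - V. z \<in> B \<longrightarrow> g z = 0) \<and>
     (\<forall>z\<in>X - V. g z = 0 \<longrightarrow> z \<in> N))"

text \<open>The parts of \<open>X - V\<close> in \<open>P\<close> and in \<open>Q\<close> are
  disjoint, closed in \<open>X\<close> and cover \<open>X - V\<close>, so a Urysohn function for
  them is two-valued there.\<close>

lemma ex_separator: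
  assumes V: "open V" "V \<inter> X \<noteq> {}" and p: "p \<in> X - V"
    and N: "open N" "connected_component_set (X - V) p \<subseteq> N" and \<B>: "topological_basis \<B>"
  obtains B g where "B \<in> \<B>" "p \<in> B" "separator (V, B, N) g"
proof -
  obtain P Q where PQ: "open P" "open Q" "X - V \<subseteq> P \<union> Q" "P \<inter> Q \<inter> (X - V) = {}"
    "connected_component_set (X - V) p \<subseteq> P" "P \<inter> (X - V) \<subseteq> N"
    using component_separation[OF V p N] by blast
  have "p \<in> P" using PQ(5) p by auto
  then obtain B where B: "B \<in> \<B>" "p \<in> B" "B \<subseteq> P" using topological_basisE[OF \<B> PQ(1)] by blast
  have cl: "closedin (top_of_set X) (X - W)" if "open W" for W
    using closedin_closed_Int[of "- W" X] closed_Compl[OF that] by (simp add: Diff_eq)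
  have "normal_space (top_of_set X)"
    by (intro metrizable_imp_normal_space metrizable_space_subtopology metrizable_space_euclidean)
  moreover have "disjnt (X - (V \<union> Q)) (X - (V \<union> P))" using PQ(3) unfolding disjnt_def by blast
  ultimately obtain g where g: "continuous_map (top_of_set X) (top_of_set {0..1::real}) g"
     "g ` (X - (V \<union> Q)) \<subseteq> {0}" "g ` (X - (V \<union> P)) \<subseteq> {1}"
    using Urysohn_lemma[of "top_of_set X" "X - (V \<union> Q)" "X - (V \<union> P)" 0 1] cl V(1) PQ(1,2)
    by (metis open_Un zero_le_one)
  have "separator (V, B, N) g"
  proof -
    have "g z = (if z \<in> P then 0 else 1)" if "z \<in> X - V" for z
    proof -
      have "z \<in> X - (V \<union> (if z \<in> P then Q else P))" using PQ(4) that by auto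
      then show ?thesis using g(2,3) by (auto split: if_splits)
    qed
    then show ?thesis
      unfolding separator_def using g(1) PQ(6) B by (auto simp: continuous_map_in_subtopology split: if_splits)
  qed
  then show thesis using that B by blast
qed

lemma ex_separating_functions:
  obtains g :: "nat \<Rightarrow> 'a \<Rightarrow> real"
  where "\<And>n. continuous_on X (g n)" "\<And>n. g n ` X \<subseteq> {0..1}"
    "\<And>U q p. \<lbrakk>open U; q \<in> X; q \<in> U; p \<in> X; p \<notin> U\<rbrakk> \<Longrightarrow>
       \<exists>V \<subseteq> U. open V \<and> q \<in> V \<and> (\<forall>N. open N \<longrightarrow> connected_component_set (X - V) p \<subseteq> N \<longrightarrow>
         (\<exists>n. g n ` (X - V) \<subseteq> {0, 1} \<and> g n p = 0 \<and> (\<forall>z\<in>X - V. g n z = 0 \<longrightarrow> z \<in> N)))"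
proof -
  obtain \<B> :: "'a set set" where \<B>: "countable \<B>" "topological_basis \<B>"
    using ex_countable_basis by blast
  define T where "T = \<B> \<times> \<B> \<times> (Union ` {A. finite A \<and> A \<subseteq> \<B>})"
  have "countable T" unfolding T_def using \<B>(1)
    by (intro countable_SIGMA countable_image countable_Collect_finite_subset)
  moreover have "T \<noteq> {}"
  proof -
    obtain V where "V \<in> \<B>" using topological_basisE[OF \<B>(2) open_UNIV] by blast
    then have "(V, V, \<Union>{}) \<in> T" unfolding T_def by blast
    then show ?thesis by blast
  qed
  ultimately have range_T: "range (from_nat_into T) = T" by (rule range_from_nat_into[rotated])
  \<comment> \<open>Triples without a separator receive the zero function, which keeps continuity
    and the bounds valid for every index.\<close>
  define g where "g n = (if \<exists>h. separator (from_nat_into T n) h then SOME h. separator (from_nat_into T n) h else (\<lambda>_. 0))" for n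
  have sep: "separator (from_nat_into T n) (g n)" if "\<exists>h. separator (from_nat_into T n) h" for n
    using someI_ex[OF that] that unfolding g_def by simp
  have g: "continuous_on X (g n) \<and> g n ` X \<subseteq> {0..1}" for n
  proof (cases "\<exists>h. separator (from_nat_into T n) h")
    case True
    show ?thesis using sep[OF True] unfolding separator_def by (auto split: prod.splits)
  next
    case False
    then show ?thesis unfolding g_def by auto
  qed
  show thesis
  proof
    fix U q p assume U: "open U" "q \<in> X" "q \<in> U" "p \<in> X" "p \<notin> U"
    obtain V where V: "V \<in> \<B>" "q \<in> V" "V \<subseteq> U" using topological_basisE[OF \<B>(2) U(1,3)] by blast
    then have oV: "open V" "V \<inter> X \<noteq> {}" "p \<in> X - V" using topological_basis_open[OF \<B>(2)] U by auto
    have "\<exists>n. g n ` (X - V) \<subseteq> {0, 1} \<and> g n p = 0 \<and> (\<forall>z\<in>X - V. g n z = 0 \<longrightarrow> z \<in> N)"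
      if N: "open N" "connected_component_set (X - V) p \<subseteq> N" for N
    proof -
      obtain A where A: "finite A" "A \<subseteq> \<B>" "connected_component_set (X - V) p \<subseteq> \<Union>A" "\<Union>A \<subseteq> N"
        using compact_subset_finite_Union_basis[OF \<B>(2) compact_component[OF oV] N(2,1)] by blast
      have "open (\<Union>A)" using A topological_basis_open[OF \<B>(2)] by blast
      then obtain B h where B: "B \<in> \<B>" "p \<in> B" "separator (V, B, \<Union>A) h"
        using ex_separator[OF oV _ A(3) \<B>(2)] by blast
      have "(V, B, \<Union>A) \<in> T" unfolding T_def using V B A by blast
      then obtain n where n: "from_nat_into T n = (V, B, \<Union>A)" using range_T by (metis rangeE)
      have "separator (V, B, \<Union>A) (g n)" using sep[of n] B(3) n by auto
      then have "g n ` (X - V) \<subseteq> {0, 1}" "g n p = 0" "\<forall>z\<in>X - V. g n z = 0 \<longrightarrow> z \<in> \<Union>A"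
        using oV(3) B(2) unfolding separator_def by auto
      then show ?thesis using A(4) by blast
    qed
    then show "\<exists>V \<subseteq> U. open V \<and> q \<in> V \<and> (\<forall>N. open N \<longrightarrow> connected_component_set (X - V) p \<subseteq> N \<longrightarrow>
         (\<exists>n. g n ` (X - V) \<subseteq> {0, 1} \<and> g n p = 0 \<and> (\<forall>z\<in>X - V. g n z = 0 \<longrightarrow> z \<in> N)))"
      using V oV by blast
  qed (use g in auto)
qed

end

section \<open>The embedding of \<open>X\<close> and the closure of its image\<close>

lemma compact_PiE_UNIV:
  fixes S :: "'i \<Rightarrow> 'b::topological_space set"
  assumes "\<And>i. compact (S i)"
  shows "compact (PiE UNIV S)"
  using assms compactin_PiE[of "\<lambda>_. euclidean" UNIV S]
  by (simp add: euclidean_product_topology)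

text \<open>A proper subcontinuum of \<open>Z\<close> meeting \<open>e\<close>
  X\<open>is projected by\<close>f\<open>into one component of some\<close>X -
  V\<open>, and no point of\<close>Z\<open>outside\<close>e \<open>X\<close> projects into
  \<open>X\<close>.\<close>

theorem singular_dense_compactification:
  fixes Y X :: "(nat \<Rightarrow> real) set"
  assumes "singular_dense_subspace Y X x y"
  obtains Z :: "(nat \<Rightarrow> real) set" and e f where "compact Z" "connected Z" "homeomorphism X (e ` X) e f" "e ` X \<subseteq> Z" "Z \<subseteq> closure (e ` X)"
    "\<And>H. \<lbrakk>compact H; connected H; H \<subseteq> Z; H \<inter> e ` X \<noteq> {}; H \<noteq> Z\<rbrakk> \<Longrightarrow> H \<subseteq> e ` X"
proof -
  interpret singular_dense_subspace Y X x y by fact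
  obtain g :: "nat \<Rightarrow> (nat \<Rightarrow> real) \<Rightarrow> real" where
    g: "\<And>n. continuous_on X (g n)" "\<And>n. g n ` X \<subseteq> {0..1}" and
    sep: "\<And>U q p. \<lbrakk>open U; q \<in> X; q \<in> U; p \<in> X; p \<notin> U\<rbrakk> \<Longrightarrow>
       \<exists>V \<subseteq> U. open V \<and> q \<in> V \<and> (\<forall>N. open N \<longrightarrow> connected_component_set (X - V) p \<subseteq> N \<longrightarrow>
         (\<exists>n. g n ` (X - V) \<subseteq> {0, 1} \<and> g n p = 0 \<and> (\<forall>z\<in>X - V. g n z = 0 \<longrightarrow> z \<in> N)))"
    using ex_separating_functions by blast
  \<comment> \<open>Interleaves the coordinates of \<open>p\<close> with the values \<open>g n p\<close>; \<open>f\<close> recovers \<open>p\<close>.\<close>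
  define e :: "(nat \<Rightarrow> real) \<Rightarrow> nat \<Rightarrow> real" where
    "e p n = (if even n then p (n div 2) else g (n div 2) p)" for p n
  define f :: "(nat \<Rightarrow> real) \<Rightarrow> nat \<Rightarrow> real" where "f z n = z (2 * n)" for z n
  have fe: "f (e p) = p" for p by (auto simp: f_def e_def)
  have eg: "e p (2 * n + 1) = g n p" for p n by (simp add: e_def)
  have coord: "continuous_on S (\<lambda>z. z i)" for i and S :: "(nat \<Rightarrow> real) set"
    by (rule continuous_on_subset[OF continuous_on_product_coordinates]) auto
  have cont_e: "continuous_on X e"
  proof (rule continuous_on_coordinatewise_then_product)
    show "continuous_on X (\<lambda>p. e p n)" for n
      by (cases "even n") (auto simp: e_def g coord)
  qed
  have cont_f: "continuous_on S f" for S
    by (rule continuous_on_coordinatewise_then_product) (auto simp: f_def coord)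
  define Z where "Z = closure (e ` X)"
  define Q :: "nat \<Rightarrow> real set" where "Q n = (if even n then (\<lambda>p. p (n div 2)) ` Y else {0..1})" for n
  have "compact (PiE UNIV Q)"
    by (rule compact_PiE_UNIV) (auto simp: Q_def intro!: compact_continuous_image coord compact_Y)
  moreover have "e ` X \<subseteq> PiE UNIV Q"
    using g(2) X_subset by (fastforce simp: e_def Q_def)
  ultimately have "compact Z" unfolding Z_def
    by (metis closure_minimal compact_Int_closed compact_imp_closed closed_closure Int_absorb1)
  have "connected Z" unfolding Z_def
    by (intro connected_imp_connected_closure connected_continuous_image cont_e connected_X)
  have homeo: "homeomorphism X (e ` X) e f"
    using cont_e cont_f fe by (auto simp: homeomorphism_def image_image)
  \<comment> \<open>\<open>z\<close> is a limit of points \<open>e p\<close> with \<open>p\<close>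
    tending to \<open>f z\<close>; if \<open>f z\<close> lies in \<open>X\<close>, continuity of
    \<open>e\<close> there forces \<open>z = e (f z)\<close>.\<close>
  have fiber: "z \<in> e ` X" if z: "z \<in> Z" "f z \<in> X" for z
  proof -
    obtain s where s: "\<And>n. s n \<in> e ` X" "s \<longlonglongrightarrow> z"
      using z(1) unfolding Z_def closure_sequential by blast
    have "(\<lambda>n. f (s n)) \<longlonglongrightarrow> f z"
      using cont_f[of UNIV] s(2) by (auto simp: continuous_on_eq_continuous_at isCont_tendsto_compose)
    moreover have "f (s n) \<in> X" for n using s(1)[of n] fe by auto
    ultimately have "(\<lambda>n. e (f (s n))) \<longlonglongrightarrow> e (f z)"
      by (intro continuous_on_tendsto_compose[OF cont_e _ z(2)]) auto
    moreover have "e (f (s n)) = s n" for n using s(1)[of n] fe by auto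
    ultimately have "z = e (f z)" using s(2) LIMSEQ_unique by auto
    then show ?thesis using z(2) by blast
  qed
  have absorb': "H \<subseteq> e ` X" if H: "compact H" "connected H" "H \<subseteq> Z" "H \<inter> e ` X \<noteq> {}" "H \<noteq> Z" for H
  proof -
    obtain p where p: "p \<in> X" "e p \<in> H" using H(4) by blast
    obtain z where z: "z \<in> Z" "z \<notin> H" using H by blast
    obtain G where G: "open G" "z \<in> G" "closure G \<inter> H = {}"
    proof -
      obtain P Q where "open P" "open Q" "z \<in> P" "H \<subseteq> Q" "P \<inter> Q = {}"
        using t3_space[OF compact_imp_closed[OF H(1)] z(2)] by blast
      moreover have "closure P \<subseteq> - Q" using calculation by (intro closure_minimal) auto
      ultimately show thesis using that by blast
    qed
    have "G \<inter> e ` X \<noteq> {}" using G z unfolding Z_def by (meson closure_iff_nhds_not_empty disjoint_iff order_refl)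
    then obtain q where q: "q \<in> X" "e q \<in> G" by blast
    obtain U where U: "open U" "X \<inter> U = X \<inter> e -` G"
      using cont_e G(1) unfolding continuous_on_open_invariant by (metis inf_commute)
    have "q \<in> U" "p \<notin> U" using q p U G closure_subset by blast+
    then obtain V where V: "V \<subseteq> U" "open V" "q \<in> V" and
      N: "\<And>N. open N \<Longrightarrow> connected_component_set (X - V) p \<subseteq> N \<Longrightarrow>
         \<exists>n. g n ` (X - V) \<subseteq> {0, 1} \<and> g n p = 0 \<and> (\<forall>z\<in>X - V. g n z = 0 \<longrightarrow> z \<in> N)"
      using sep[OF U(1) q(1) _ p(1)] by metis
    have pV: "p \<in> X - V" using p V \<open>p \<notin> U\<close> by blast
    have "e ` X \<subseteq> G \<union> e ` (X - V)" using U V by blast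
    then have "Z \<subseteq> closure G \<union> closure (e ` (X - V))"
      unfolding Z_def using closure_mono closure_Un by metis
    then have HV: "H \<subseteq> closure (e ` (X - V))" using H(3) G(3) by blast
    \<comment> \<open>Otherwise some \<open>g n\<close> vanishes at \<open>p\<close> and, off
      \<open>V\<close>, only inside a neighbourhood \<open>N\<close> of the component disjoint from
      a neighbourhood \<open>M\<close> of \<open>f h\<close>. Its coordinate is two-valued on the
      connected set \<open>H\<close>, hence 0 there, and nearby points \<open>e w\<close> give
      \<open>w \<in> N \<inter> M\<close>.\<close>
    have "f h \<in> connected_component_set (X - V) p" if h: "h \<in> H" for h
    proof (rule ccontr)
      assume "f h \<notin> connected_component_set (X - V) p"
      moreover have "closed (connected_component_set (X - V) p)"
        using compact_component[OF V(2) _ pV] q V compact_imp_closed by blast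
      ultimately obtain N M where NM: "open N" "open M" "f h \<in> M" "connected_component_set (X - V) p \<subseteq> N" "M \<inter> N = {}"
        using t3_space by metis
      then obtain n where n: "g n ` (X - V) \<subseteq> {0, 1}" "g n p = 0" "\<And>z. z \<in> X - V \<Longrightarrow> g n z = 0 \<Longrightarrow> z \<in> N"
        using N by metis
      let ?c = "\<lambda>z :: nat \<Rightarrow> real. z (2 * n + 1)"
      have "closed (?c -` {0, 1})"
        by (rule closed_vimage) (auto simp: coord)
      moreover have "e ` (X - V) \<subseteq> ?c -` {0, 1}" using n(1) eg by auto
      ultimately have Hc: "H \<subseteq> ?c -` {0, 1}" using HV closure_minimal by blast
      have "connected (?c ` H)"
        by (intro connected_continuous_image coord H)
      moreover have "0 \<in> ?c ` H" using p n(2) eg by (metis image_eqI)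
      moreover have "1 / 2 \<notin> ?c ` H" using Hc by auto
      moreover have "1 / 2 \<in> {0..1::real}" by simp
      ultimately have "1 \<notin> ?c ` H"
        using connected_contains_Icc[of "?c ` H" 0 1] by blast
      then have "?c h \<noteq> 1" using imageI[OF h, of ?c] by metis
      then have "?c h < 1" using Hc h by auto
      moreover have "open {z. ?c z < 1}" "open (f -` M)"
        using coord[of UNIV] cont_f[of UNIV] NM(2) by (auto intro!: open_Collect_less open_vimage)
      ultimately have "open ({z. ?c z < 1} \<inter> f -` M)" "h \<in> {z. ?c z < 1} \<inter> f -` M \<inter> closure (e ` (X - V))"
        using NM HV h by auto
      then obtain w where w: "w \<in> X - V" "e w \<in> {z. ?c z < 1} \<inter> f -` M"
        using open_Int_closure_eq_empty[of "{z. ?c z < 1} \<inter> f -` M" "e ` (X - V)"] by blast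
      then have "g n w = 0" using n(1) eg by force
      then have "w \<in> N" "w \<in> M" using n(3) w fe by auto
      then show False using NM by blast
    qed
    then show ?thesis
      using fiber H(3) connected_component_subset by fastforce
  qed
  show thesis
  proof (rule that[OF \<open>compact Z\<close> \<open>connected Z\<close> homeo])
    show "e ` X \<subseteq> Z" "Z \<subseteq> closure (e ` X)" unfolding Z_def by (rule closure_subset) (rule order_refl)
  qed (rule absorb')
qed

section \<open>Indecomposability and identification of the composant\<close>

lemma (in singular_dense_subspace) not_compact_X: "\<not> compact X"
  using closure_X y_in y_notin compact_imp_closed closure_closed by blast

theorem singular_dense_composant:
  fixes Y X :: "(nat \<Rightarrow> real) set"
  assumes "singular_dense_subspace Y X x y"
  shows "\<exists>(Z :: (nat \<Rightarrow> real) topology) P. indecomposable_continuum Z \<and>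
           (\<exists>z \<in> topspace Z. P = composant Z z) \<and> top_of_set X homeomorphic_space subtopology Z P"
proof -
  interpret singular_dense_subspace Y X x y by fact
  obtain Z :: "(nat \<Rightarrow> real) set" and e f where Z: "compact Z" "connected Z"
    and homeo: "homeomorphism X (e ` X) e f" and eX: "e ` X \<subseteq> Z" "Z \<subseteq> closure (e ` X)"
    and absorb': "\<And>H. \<lbrakk>compact H; connected H; H \<subseteq> Z; H \<inter> e ` X \<noteq> {}; H \<noteq> Z\<rbrakk> \<Longrightarrow> H \<subseteq> e ` X"
    using singular_dense_compactification[OF assms] by blast
  have cont: "continuous_on X e" "continuous_on (e ` X) f" and fe: "\<And>p. p \<in> X \<Longrightarrow> f (e p) = p"
    using homeo unfolding homeomorphism_def by auto
  let ?Z = "top_of_set Z"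
  have proper: "proper_subcontinuum ?Z H \<longleftrightarrow> H \<noteq> {} \<and> compact H \<and> connected H \<and> H \<subseteq> Z \<and> H \<noteq> Z" for H
    unfolding proper_subcontinuum_def subcontinuum_def
    by (auto simp: compactin_subtopology connectedin_subtopology)
  have not_Z: "e ` K \<noteq> Z" if "compact K" "K \<subseteq> X" for K
  proof
    assume "e ` K = Z"
    have "a \<in> K" if "a \<in> X" for a
    proof -
      have "e a \<in> e ` K" using eX(1) \<open>e ` K = Z\<close> that by blast
      then show ?thesis using fe[OF that] fe \<open>K \<subseteq> X\<close> by auto
    qed
    then have "X \<subseteq> K" by blast
    then show False using that not_compact_X by (metis subset_antisym)
  qed
  have "\<exists>a\<in>Z. \<exists>b\<in>Z. a \<noteq> b"
    using two_points_X eX(1) fe by (metis image_subset_iff)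
  then have "continuum ?Z"
    unfolding continuum_def using Z
    using connectedin_def[of euclidean Z]
    by (simp add: compact_space_subtopology metrizable_space_subtopology metrizable_space_euclidean)
  moreover have "\<not> decomposable ?Z"
  proof
    assume "decomposable ?Z"
    then obtain H K where HK: "proper_subcontinuum ?Z H" "proper_subcontinuum ?Z K" "Z = H \<union> K"
      unfolding decomposable_def by auto
    \<comment> \<open>\<open>B\<close> is closed and proper, so it cannot contain the dense set
      \<open>e\<close> X\<open>; hence\<close>A\<open>meets this set and is absorbed. Applied to
      both pieces this makes\<close>e \<open>X\<close>, and so \<open>X\<close>, compact.\<close>
    have sub: "A \<subseteq> e ` X" if "proper_subcontinuum ?Z A" "proper_subcontinuum ?Z B" "Z = A \<union> B" for A B
    proof -
      have "\<not> e ` X \<subseteq> B"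
        using that(2) eX(2) closure_minimal[of "e ` X" B] compact_imp_closed unfolding proper by blast
      then have "A \<inter> e ` X \<noteq> {}" using that(3) eX(1) by blast
      then show ?thesis using absorb' that(1) unfolding proper by blast
    qed
    have "H \<subseteq> e ` X" "K \<subseteq> e ` X" using sub[OF HK] sub[OF HK(2,1)] HK(3) by auto
    then have "Z = e ` X" using HK(3) eX(1) by blast
    then have "compact (f ` e ` X)" using Z(1) cont(2) compact_continuous_image by metis
    then show False using not_compact_X fe by (simp add: image_image)
  qed
  moreover obtain p where p: "p \<in> X" using two_points_X by blast
  have xX: "x \<in> X" using reach[OF p] by blast
  have "e ` X = composant ?Z (e x)"
  proof
    show "composant ?Z (e x) \<subseteq> e ` X"
      unfolding composant_def proper using absorb' xX by blast
    show "e ` X \<subseteq> composant ?Z (e x)"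
    proof
      fix w assume "w \<in> e ` X"
      then obtain q where q: "q \<in> X" "w = e q" by blast
      obtain K where K: "compact K" "connected K" "K \<subseteq> X" "x \<in> K" "q \<in> K" using reach[OF q(1)] by blast
      have "compact (e ` K)" "connected (e ` K)"
        using K cont(1) by (meson compact_continuous_image connected_continuous_image continuous_on_subset)+
      then have "proper_subcontinuum ?Z (e ` K)" unfolding proper using K eX(1) not_Z[OF K(1,3)] by blast
      then show "w \<in> composant ?Z (e x)" unfolding composant_def using K q by blast
    qed
  qed
  moreover have "top_of_set X homeomorphic_space subtopology ?Z (e ` X)"
  proof -
    have "subtopology ?Z (e ` X) = top_of_set (e ` X)"
      using eX(1) by (simp add: subtopology_subtopology inf.absorb2)
    then show ?thesis
      using homeo unfolding homeomorphic_space_def homeomorphic_maps_def homeomorphism_def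
      by (intro exI[of _ e] exI[of _ f]) auto
  qed
  ultimately show ?thesis
    unfolding indecomposable_continuum_def using eX(1) xX
    by (intro exI[of _ ?Z] exI[of _ "e ` X"]) auto
qed

section \<open>Transfer to abstract continua\<close>

text \<open>Points are sent to their distances from a countable dense set built from finite nets; a
  continuous injection of a compact space into a Hausdorff one is an embedding.\<close>

lemma compact_metrizable_embedding:
  assumes "compact_space Y" "metrizable_space Y"
  obtains h :: "'a \<Rightarrow> nat \<Rightarrow> real" where "homeomorphic_map Y (top_of_set (h ` topspace Y)) h"
proof -
  obtain M d where md: "Metric_space M d" "Y = Metric_space.mtopology M d"
    using assms(2) unfolding metrizable_space_def by blast
  interpret Metric_space M d by fact
  have M: "topspace Y = M" using md by simp
  have "mtotally_bounded M"
    using assms(1) md(2) M compactin_imp_mtotally_bounded unfolding compact_space_def by auto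
  then have "\<exists>K. finite K \<and> K \<subseteq> M \<and> M \<subseteq> (\<Union>c\<in>K. mball c (inverse (Suc n)))" for n
    unfolding mtotally_bounded_def by (meson inverse_positive_iff_positive of_nat_0_less_iff zero_less_Suc)
  then obtain K where K: "\<And>n. finite (K n)" "\<And>n. K n \<subseteq> M" "\<And>n. M \<subseteq> (\<Union>c\<in>K n. mball c (inverse (Suc n)))"
    by metis
  define D where "D = (\<Union>n. K n)"
  have D: "countable D" "D \<subseteq> M" unfolding D_def using K by (auto intro: countable_finite)
  define h where "h p n = d (from_nat_into D n) p" for p n
  have inj: "inj_on h M"
  proof (rule inj_onI, rule ccontr)
    fix p q assume pq: "p \<in> M" "q \<in> M" "h p = h q" "p \<noteq> q"
    then have "d p q / 2 > 0" by simp
    then obtain n where n: "inverse (real (Suc n)) < d p q / 2" using reals_Archimedean by blast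
    obtain c where c: "c \<in> K n" "p \<in> mball c (inverse (Suc n))" using K(3)[of n] pq(1) by blast
    then have cD: "c \<in> D" unfolding D_def by blast
    then obtain m where "from_nat_into D m = c" using from_nat_into_surj[OF D(1)] by blast
    then have "d c p = d c q" using fun_cong[OF pq(3), of m] by (simp add: h_def)
    moreover have "d c p < inverse (real (Suc n))" using c(2) by simp
    moreover have "d p q \<le> d p c + d c q" using triangle pq cD D(2) by blast
    ultimately show False using n commute[of p c] by simp
  qed
  have "continuous_map Y euclidean h"
  proof -
    have "continuous_map Y euclideanreal (\<lambda>p. h p n)" for n
    \<comment> \<open>For empty \<open>D\<close> the enumeration has an unspecified value, but then
      the space is empty.\<close>
    proof (cases "D = {}")
      case True
      then have "M = {}" using K(3)[of 0] unfolding D_def by auto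
      then show ?thesis using M by (simp add: continuous_map_on_empty)
    next
      case False
      then have "from_nat_into D n \<in> M" using D(2) from_nat_into[OF False, of n] by blast
      then show ?thesis
        using continuous_on_mdist[of "from_nat_into D n" "metric (M, d)"] md(2)
        by (simp add: h_def mtopology_of_def mspace_metric mdist_metric)
    qed
    then show ?thesis
      using continuous_map_componentwise_UNIV[of Y "\<lambda>_. euclideanreal" h] by (simp add: euclidean_product_topology)
  qed
  then have "homeomorphic_map Y (top_of_set (h ` topspace Y)) h"
    using assms(1) inj M
    by (intro continuous_imp_homeomorphic_map)
      (auto simp: continuous_map_in_subtopology Hausdorff_space_subtopology)
  then show thesis by (rule that)
qed

lemma nowhere_dense_in_Un:
  assumes "nowhere_dense_in Y A" "nowhere_dense_in Y B"
  shows "nowhere_dense_in Y (A \<union> B)"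
  using assms unfolding nowhere_dense_in_def
  by (simp add: closure_of_Un interior_of_union_eq_empty)

text \<open>For \<open>absorb\<close>, a nowhere dense continuum meeting \<open>X\<close> at
  \<open>q\<close> is joined to one containing \<open>x\<close> and \<open>q\<close>; the union is
  nowhere dense and contains \<open>x\<close>, so it lies in the meager composant.\<close>

lemma singular_dense_subspace_image:
  fixes h :: "'a \<Rightarrow> 'b::{metric_space,second_countable_topology}"
  assumes Y: "continuum Y" and X: "X = meager_composant Y x" and dense: "dense_subset_of Y X"
    and sing: "singular_wrt Y X y" and h: "homeomorphic_map Y (top_of_set Y') h"
  shows "singular_dense_subspace Y' (h ` X) (h x) (h y)"
proof -
  have XY: "X \<subseteq> topspace Y" and clX: "Y closure_of X = topspace Y"
    using dense unfolding dense_subset_of_def by auto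
  have Y': "Y' = h ` topspace Y" using homeomorphic_imp_surjective_map[OF h] by simp
  have inj: "inj_on h (topspace Y)" using homeomorphic_imp_injective_map[OF h] .
  have conn: "connected (h ` C) \<longleftrightarrow> connectedin Y C" if "C \<subseteq> topspace Y" for C
    using homeomorphic_map_connectedness[OF h that] that Y' by (auto simp: connectedin_subtopology)
  have comp: "compact (h ` C) \<longleftrightarrow> compactin Y C" if "C \<subseteq> topspace Y" for C
    using homeomorphic_map_compactness[OF h that] that Y' by (auto simp: compactin_subtopology)
  have clos: "Y' \<inter> closure (h ` C) = h ` (Y closure_of C)" if "C \<subseteq> topspace Y" for C
    using homeomorphic_map_closure_of[OF h that] that Y' by (auto simp: closure_of_subtopology Int_absorb1 image_mono)
  have lift: "\<exists>C \<subseteq> A. C' = h ` C" if "C' \<subseteq> h ` A" for A C'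
    using that by (meson subset_imageE)
  have haus: "Hausdorff_space Y"
    using Y unfolding continuum_def by (simp add: metrizable_imp_Hausdorff_space)
  have yY: "y \<in> topspace Y" and connX: "connectedin Y X" using sing unfolding singular_wrt_def by auto
  show ?thesis
  proof
    show "compact Y'" using Y comp[of "topspace Y"] unfolding continuum_def Y' compact_space_def by auto
    show "h ` X \<subseteq> Y'" using XY Y' by blast
    show "Y' \<subseteq> closure (h ` X)" using clos[OF XY] clX Y' by blast
    show "h y \<in> Y'" using yY Y' by blast
    show "\<exists>a\<in>Y'. a \<noteq> h y"
      using Y inj yY unfolding continuum_def Y' by (metis image_eqI inj_on_eq_iff)
    show "connected (h ` X)" using conn[OF XY] connX by simp
    show "h ` X \<subseteq> closure C'" if C': "C' \<subseteq> h ` X" "connected C'" "h y \<in> closure C'" for C'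
    proof -
      obtain C where C: "C \<subseteq> X" "C' = h ` C" using lift[OF C'(1)] by blast
      have CY: "C \<subseteq> topspace Y" using C XY by blast
      have "h y \<in> h ` (Y closure_of C)" using clos[OF CY] C' C Y' yY by blast
      then have "y \<in> Y closure_of C"
        using inj yY closure_of_subset_topspace by (metis imageE inj_on_eq_iff subsetD)
      then have "(subtopology Y X) closure_of C = X"
        using sing C conn[OF CY] C' unfolding singular_wrt_def by blast
      then have "X \<subseteq> Y closure_of C" using closure_of_subtopology_subset[of Y X C] by simp
      then show ?thesis using clos[OF CY] C(2) by blast
    qed
    show "\<exists>K'. compact K' \<and> connected K' \<and> K' \<subseteq> h ` X \<and> h x \<in> K' \<and> p' \<in> K'" if p': "p' \<in> h ` X" for p'
    proof -
      obtain p where p: "p \<in> X" "p' = h p" using p' by blast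
      obtain K where K: "subcontinuum Y K" "nowhere_dense_in Y K" "x \<in> K" "p \<in> K"
        using p(1) unfolding X meager_composant_def by blast
      have "K \<subseteq> X" using K unfolding X meager_composant_def by blast
      moreover have "K \<subseteq> topspace Y" using calculation XY by blast
      ultimately show ?thesis
        using K p comp conn unfolding subcontinuum_def by (intro exI[of _ "h ` K"]) auto
    qed
    show "K' \<subseteq> h ` X" if K': "compact K'" "connected K'" "K' \<subseteq> Y'" "K' \<inter> h ` X \<noteq> {}"
      and empty_int: "\<And>U. open U \<Longrightarrow> U \<inter> Y' \<noteq> {} \<Longrightarrow> \<not> U \<inter> Y' \<subseteq> K'" for K'
    proof -
      obtain K where K: "K \<subseteq> topspace Y" "K' = h ` K" using lift K'(3) Y' by blast
      have cK: "compactin Y K" "connectedin Y K" using comp conn K K' by auto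
      have clK: "Y closure_of K = K"
        using closure_of_closedin compactin_imp_closedin[OF haus cK(1)] by blast
      \<comment> \<open>A nonempty interior would map onto a relatively open subset of
        \<open>Y'\<close> inside \<open>K'\<close>, excluded by \<open>empty_int\<close>.\<close>
      have "Y interior_of K = {}"
      proof (rule ccontr)
        let ?W = "Y interior_of K"
        assume ne: "?W \<noteq> {}"
        have "openin (top_of_set Y') (h ` ?W)"
          using homeomorphic_map_openness[OF h, of ?W] by (simp add: interior_of_subset_topspace)
        then obtain U where "open U" "h ` ?W = Y' \<inter> U" using openin_open by metis
        moreover have "h ` ?W \<subseteq> K'" using interior_of_subset[of Y K] K(2) by blast
        ultimately show False using empty_int[of U] ne by blast
      qed
      then have "nowhere_dense_in Y K" unfolding nowhere_dense_in_def using K clK by simp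
      obtain q where q: "q \<in> X" "q \<in> K"
      proof -
        obtain w where "w \<in> h ` K" "w \<in> h ` X" using K'(4) K(2) by blast
        then obtain r q where "r \<in> K" "w = h r" "q \<in> X" "w = h q" by blast
        moreover have "r = q" using inj_onD[OF inj, of r q] calculation K(1) XY by auto
        ultimately show thesis using that by blast
      qed
      obtain L where L: "subcontinuum Y L" "nowhere_dense_in Y L" "x \<in> L" "q \<in> L"
        using q(1) unfolding X meager_composant_def by blast
      have "subcontinuum Y (K \<union> L)"
        using L q cK unfolding subcontinuum_def by (auto intro: connectedin_Un compactin_Un)
      moreover have "nowhere_dense_in Y (K \<union> L)"
        using nowhere_dense_in_Un \<open>nowhere_dense_in Y K\<close> L(2) .
      ultimately have "K \<union> L \<subseteq> X" using L(3) unfolding X meager_composant_def by blast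
      then show ?thesis using K(2) by blast
    qed
  qed
qed

theorem theorem1p1:
  fixes Y :: "'a topology" and X :: "'a set"
  assumes "continuum Y"
    and "\<exists>x \<in> topspace Y. X = meager_composant Y x"
    and "singular_dense_in Y X"
  shows "\<exists>(Z :: (nat \<Rightarrow> real) topology) P.
           indecomposable_continuum Z \<and>
           (\<exists>z \<in> topspace Z. P = composant Z z) \<and>
           subtopology Y X homeomorphic_space subtopology Z P"
proof -
  obtain x y where X: "X = meager_composant Y x" and y: "singular_wrt Y X y" and dense: "dense_subset_of Y X"
    using assms(2,3) unfolding singular_dense_in_def singular_in_def by blast
  obtain h :: "'a \<Rightarrow> nat \<Rightarrow> real" where h: "homeomorphic_map Y (top_of_set (h ` topspace Y)) h"
    using compact_metrizable_embedding assms(1) unfolding continuum_def by metis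
  have XY: "X \<subseteq> topspace Y" using dense unfolding dense_subset_of_def by blast
  have "subtopology Y X homeomorphic_space subtopology (top_of_set (h ` topspace Y)) (h ` X)"
    using homeomorphic_map_subtopologies[OF h, of X "h ` X"] XY
    by (intro homeomorphic_map_imp_homeomorphic_space) auto
  then have "subtopology Y X homeomorphic_space top_of_set (h ` X)"
    using XY by (simp add: subtopology_subtopology inf.absorb2 image_mono)
  then show ?thesis
    using singular_dense_composant[OF singular_dense_subspace_image[OF assms(1) X dense y h]]
      homeomorphic_space_trans by blast
qed

end
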